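(* For every finite tree $T$, $$\psi(T)\le dim(T)+eqdim(T).$$
   Context: $d(x,y)$ denotes the graph distance in a connected graph $G$. A set $S\subseteq V(G)$ is a distance-equalizer set of $G$ if for every two distinct vertices $x,y\in V(G)\setminus S$ there is $w\in S$ with $d(x,w)=d(y,w)$; the equidistant dimension $eqdim(G)$ is the minimum cardinality of a distance-equalizer set. A set $S\subseteq V(G)$ is a resolving set if for every two distinct vertices $x,y\in V(G)$ there is $v\in S$ with $d(v,x)\ne d(v,y)$; the metric dimension $dim(G)$ is the minimum cardinality of a resolving set. A set $S\subseteq V(G)$ is a doubly resolving set if for every two distinct vertices $x,y\in V(G)$ there are $u,v\in S$ with $d(u,x)-d(u,y)\ne d(v,x)-d(v,y)$; $\psi(G)$ is the minimum cardinality of a doubly resolving set. *)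

theory Defs
  imports "Graph_Theory.Graph_Theory"
begin

text \<open>
  Finite simple undirected graphs are the \<^locale>\<open>graph\<close>s of the library: finite,
  loop-free digraphs without parallel arcs whose arc relation is symmetric, so that an
  edge is a pair of opposite arcs.

  The library predicate \<^const>\<open>tree\<close> is not usable here. It forbids every directed
  cycle, and going back and forth along a single edge is a directed cycle of length 2;
  so a \<^locale>\<open>graph\<close> with an edge never satisfies it. The cycles of the undirected
  graph are the directed cycles of length at least 3. Note that \<^const>\<open>connected\<close>
  includes that there is at least one vertex.
\<close>

definition finite_tree :: "('a, 'b) pre_digraph \<Rightarrow> bool" where
  "finite_tree G \<longleftrightarrow>
     graph G \<and> connected G \<and> \<not> (\<exists>p. pre_digraph.cycle G p \<and> length p \<ge> 3)"

text \<open>Only meaningful if \<open>v\<close> is reachable from \<open>u\<close>.\<close>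

definition gdist :: "('a, 'b) pre_digraph \<Rightarrow> 'a \<Rightarrow> 'a \<Rightarrow> nat" where
  "gdist G u v = (LEAST n. \<exists>p. pre_digraph.awalk G u p v \<and> length p = n)"

lemma (in wf_digraph) gdist_eq_mu:
  assumes "u \<rightarrow>\<^sup>* v"
  shows "\<mu> (\<lambda>_. 1) u v = ereal (real (gdist G u v))"
proof -
  obtain q where "awalk u q v"
    using assms by (auto simp: reachable_awalk)
  then have ex: "\<exists>n. \<exists>p. awalk u p v \<and> length p = n"
    by blast
  obtain p where p: "awalk u p v" "length p = gdist G u v"
    using LeastI_ex[OF ex] unfolding gdist_def by blast
  have cost: "awalk_cost (\<lambda>_. 1) r = real (length r)" for r :: "'b awalk"
    by (induction r) auto
  have least: "gdist G u v \<le> length r" if "awalk u r v" for r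
    unfolding gdist_def using that by (intro Least_le) blast
  show ?thesis
    unfolding \<mu>_def cost
  proof (rule antisym)
    show "(INF r\<in>{r. awalk u r v}. ereal (real (length r))) \<le> ereal (real (gdist G u v))"
      using p by (metis (mono_tags, lifting) INF_lower mem_Collect_eq)
    show "ereal (real (gdist G u v)) \<le> (INF r\<in>{r. awalk u r v}. ereal (real (length r)))"
      using least by (intro INF_greatest) simp
  qed
qed

definition distance_equalizer :: "('a, 'b) pre_digraph \<Rightarrow> 'a set \<Rightarrow> bool" where
  "distance_equalizer G S \<longleftrightarrow> S \<subseteq> verts G \<and>
     (\<forall>x \<in> verts G - S. \<forall>y \<in> verts G - S. x \<noteq> y \<longrightarrow>
       (\<exists>w \<in> S. gdist G x w = gdist G y w))"

definition resolving :: "('a, 'b) pre_digraph \<Rightarrow> 'a set \<Rightarrow> bool" where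
  "resolving G S \<longleftrightarrow> S \<subseteq> verts G \<and>
     (\<forall>x \<in> verts G. \<forall>y \<in> verts G. x \<noteq> y \<longrightarrow>
       (\<exists>v \<in> S. gdist G v x \<noteq> gdist G v y))"

definition doubly_resolving :: "('a, 'b) pre_digraph \<Rightarrow> 'a set \<Rightarrow> bool" where
  "doubly_resolving G S \<longleftrightarrow> S \<subseteq> verts G \<and>
     (\<forall>x \<in> verts G. \<forall>y \<in> verts G. x \<noteq> y \<longrightarrow>
       (\<exists>u \<in> S. \<exists>v \<in> S.
         int (gdist G u x) - int (gdist G u y) \<noteq> int (gdist G v x) - int (gdist G v y)))"

text \<open>
  In a connected \<^locale>\<open>graph\<close> the whole vertex set has each of the three properties,
  so each minimum is attained.
\<close>

definition eqdim :: "('a, 'b) pre_digraph \<Rightarrow> nat" where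
  "eqdim G = (LEAST n. \<exists>S. distance_equalizer G S \<and> card S = n)"

definition metric_dim :: "('a, 'b) pre_digraph \<Rightarrow> nat" where
  "metric_dim G = (LEAST n. \<exists>S. resolving G S \<and> card S = n)"

definition psi :: "('a, 'b) pre_digraph \<Rightarrow> nat" where
  "psi G = (LEAST n. \<exists>S. doubly_resolving G S \<and> card S = n)"

end

theory Submission
  imports Defs
begin

text \<open>
  Everything goes through the set of leaves. It is doubly resolving in a tree: extend the
  path between two vertices \<open>x \<noteq> y\<close> at both ends until it cannot be extended any further;
  its ends are then leaves \<open>u\<close>, \<open>v\<close>, and seen from them the difference of the distances to
  \<open>x\<close> and \<open>y\<close> is \<open>- d(x,y)\<close> and \<open>d(x,y)\<close>. This is \<open>leaves_doubly_resolving\<close>. So \<open>\<psi>\<close> is at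
  most the number of leaves.

  On the other hand, in every connected graph the number of leaves is at most
  \<open>card R + card S\<close> for a resolving set \<open>R\<close> and a distance-equalizer set \<open>S\<close>, which is
  \<open>card_leaves_le\<close>. The reason is that the distances from any other vertex to a leaf and to
  its only neighbour differ by one. Hence nothing outside the pair is equidistant from a leaf
  and its neighbour, so that \<open>S\<close> contains one of the two; and two leaves at the same vertex
  are equidistant from all other vertices, so that \<open>R\<close> contains all leaves at a given vertex
  except possibly one. Therefore sending a leaf outside \<open>R\<close> to itself if it lies in \<open>S\<close>, and
  to its neighbour otherwise, is an injection into \<open>S\<close>.
\<close>

section \<open>Distances in connected graphs\<close>

locale connected_graph = graph +
  assumes connected: "connected G"
begin

lemma adj_sym: "u \<rightarrow>\<^bsub>G\<^esub> v \<Longrightarrow> v \<rightarrow>\<^bsub>G\<^esub> u"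
  by (rule arcs_ends_symmetric[OF sym_arcs])

lemma adj_neq: "u \<rightarrow>\<^bsub>G\<^esub> v \<Longrightarrow> u \<noteq> v"
  by (auto simp: arcs_ends_conv dest: no_loops)

lemma gdist_le: "awalk u p v \<Longrightarrow> gdist G u v \<le> length p"
  unfolding gdist_def by (rule Least_le) blast

lemma shortest_awalk:
  assumes "u \<in> verts G" "v \<in> verts G"
  obtains p where "awalk u p v" "length p = gdist G u v"
proof -
  have "strongly_connected G"
    using symmetric_connected_imp_strongly_connected[OF sym_arcs connected] .
  then have "u \<rightarrow>\<^sup>* v"
    using assms by (auto simp: strongly_connected_def)
  then have "\<exists>n p. awalk u p v \<and> length p = n"
    by (auto simp: reachable_awalk)
  from LeastI_ex[OF this] show thesis
    using that unfolding gdist_def by blast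
qed

lemma awalk_reverse: "awalk u p v \<Longrightarrow> \<exists>q. awalk v q u \<and> length q = length p"
proof (induction p arbitrary: u)
  case Nil
  then show ?case by (auto simp: awalk_Nil_iff)
next
  case (Cons e p)
  then obtain q where q: "awalk v q (head G e)" "length q = length p"
    by (auto simp: awalk_Cons_iff)
  have e: "e \<in> arcs G" "tail G e = u"
    using Cons.prems by (auto simp: awalk_Cons_iff)
  then obtain e' where e': "e' \<in> arcs G" "tail G e' = head G e" "head G e' = u"
    using sym_arcs unfolding symmetric_conv by metis
  have "awalk v (q @ [e']) u"
    using q(1) e' by (intro awalk_appendI[of _ _ "head G e"]) (auto dest: arc_implies_awalk)
  with q(2) show ?case by (intro exI[of _ "q @ [e']"]) simp
qed

lemma gdist_sym:
  assumes "u \<in> verts G" "v \<in> verts G"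
  shows "gdist G u v = gdist G v u"
proof -
  have "gdist G v u \<le> gdist G u v" if "u \<in> verts G" "v \<in> verts G" for u v
    using shortest_awalk[OF that] awalk_reverse gdist_le by metis
  with assms show ?thesis by (simp add: antisym)
qed

lemma gdist_triangle:
  assumes "u \<in> verts G" "v \<in> verts G" "w \<in> verts G"
  shows "gdist G u w \<le> gdist G u v + gdist G v w"
proof -
  obtain p where p: "awalk u p v" "length p = gdist G u v"
    using assms by (metis shortest_awalk)
  obtain q where q: "awalk v q w" "length q = gdist G v w"
    using assms by (metis shortest_awalk)
  show ?thesis
    using gdist_le[OF awalk_appendI[OF p(1) q(1)]] p(2) q(2) by simp
qed

lemma gdist_self: "u \<in> verts G \<Longrightarrow> gdist G u u = 0"
  using gdist_le[of u "[]" u] by (simp add: awalk_Nil_iff)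

lemma gdist_eq_0D: "u \<in> verts G \<Longrightarrow> v \<in> verts G \<Longrightarrow> gdist G u v = 0 \<Longrightarrow> u = v"
  by (metis shortest_awalk awalk_Nil_iff length_0_conv)

lemma gdist_adj: "u \<rightarrow>\<^bsub>G\<^esub> v \<Longrightarrow> gdist G u v \<le> 1"
  by (auto simp: arcs_ends_conv dest!: arc_implies_awalk gdist_le)

lemma gdist_step:
  assumes "u \<in> verts G" "v \<in> verts G" "u \<noteq> v"
  obtains w where "u \<rightarrow>\<^bsub>G\<^esub> w" "gdist G u v = Suc (gdist G w v)"
proof -
  obtain p where p: "awalk u p v" "length p = gdist G u v"
    using assms by (metis shortest_awalk)
  then obtain e q where [simp]: "p = e # q"
    using assms(3) by (cases p) (auto simp: awalk_Nil_iff)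
  have e: "e \<in> arcs G" "tail G e = u" and q: "awalk (head G e) q v"
    using p(1) by (auto simp: awalk_Cons_iff)
  have adj: "u \<rightarrow>\<^bsub>G\<^esub> head G e"
    using e by (auto simp: arcs_ends_conv)
  have "gdist G u v \<le> gdist G u (head G e) + gdist G (head G e) v"
    using e assms by (intro gdist_triangle) auto
  then have "gdist G u v = Suc (gdist G (head G e) v)"
    using gdist_adj[OF adj] gdist_le[OF q] p(2) by simp
  with adj show thesis by (rule that)
qed

lemma resolving_verts: "resolving G (verts G)"
  unfolding resolving_def using gdist_self gdist_eq_0D by (metis order_refl)

end


section \<open>Leaves against resolving and distance-equalizer sets\<close>

definition leaf :: "('a, 'b) pre_digraph \<Rightarrow> 'a \<Rightarrow> bool" where
  "leaf G v \<longleftrightarrow> (\<exists>!w. v \<rightarrow>\<^bsub>G\<^esub> w)"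

context connected_graph
begin

lemma leaf_in_verts: "leaf G l \<Longrightarrow> l \<in> verts G"
  unfolding leaf_def using adj_in_verts(1) by blast

lemma gdist_leaf:
  assumes "leaf G l" "l \<rightarrow>\<^bsub>G\<^esub> x" "v \<in> verts G" "v \<noteq> l"
  shows "gdist G l v = Suc (gdist G x v)" "gdist G v l = Suc (gdist G v x)"
proof -
  have verts: "l \<in> verts G" "x \<in> verts G"
    using assms(2) by (auto intro: adj_in_verts)
  obtain w where w: "l \<rightarrow>\<^bsub>G\<^esub> w" "gdist G l v = Suc (gdist G w v)"
    using gdist_step[OF verts(1) assms(3)] assms(4) by metis
  have "w = x"
    using w(1) assms(1,2) unfolding leaf_def by blast
  with w(2) show "gdist G l v = Suc (gdist G x v)" by simp
  then show "gdist G v l = Suc (gdist G v x)"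
    using verts assms(3) by (simp add: gdist_sym)
qed

text \<open>
  The map \<open>f\<close> that sends a leaf to itself or to its neighbour could collide outside \<open>R\<close> in
  two ways. Two leaves at the same vertex would be equidistant from all of \<open>R\<close>. And if a leaf
  were the neighbour of another leaf, a vertex of \<open>R\<close> that separates the two would be farther
  from each than from the other.
\<close>

lemma card_leaves_le:
  assumes R: "resolving G R" and S: "distance_equalizer G S"
  shows "card {l. leaf G l} \<le> card R + card S"
proof -
  let ?L = "{l. leaf G l}"
  define nb where "nb l = (THE w. l \<rightarrow>\<^bsub>G\<^esub> w)" for l
  define f where "f l = (if l \<in> S then l else nb l)" for l
  have nb: "l \<rightarrow>\<^bsub>G\<^esub> nb l" if "leaf G l" for l
    using that unfolding leaf_def nb_def by (rule theI')
  have fin: "finite R" "finite S"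
    using R S finite_subset[OF _ finite_verts]
    unfolding resolving_def distance_equalizer_def by blast+
  have fin_L: "finite ?L"
    by (rule finite_subset[OF _ finite_verts]) (auto dest: leaf_in_verts)
  have "f l \<in> S" if l: "leaf G l" for l
  proof (rule ccontr)
    assume "f l \<notin> S"
    then have "l \<notin> S" "nb l \<notin> S"
      by (auto simp: f_def split: if_splits)
    then obtain w where w: "w \<in> S" "gdist G l w = gdist G (nb l) w"
      using S adj_in_verts[OF nb[OF l]] adj_neq[OF nb[OF l]]
      unfolding distance_equalizer_def by blast
    have "w \<in> verts G" "w \<noteq> l"
      using S w(1) \<open>l \<notin> S\<close> unfolding distance_equalizer_def by auto
    then show False
      using gdist_leaf(1)[OF l nb[OF l]] w(2) by auto
  qed
  then have img: "f ` (?L - R) \<subseteq> S" by blast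
  have separate: "\<exists>v \<in> R. v \<in> verts G \<and> v \<noteq> l \<and> v \<noteq> m \<and> gdist G v l \<noteq> gdist G v m"
    if "leaf G l" "leaf G m" "l \<notin> R" "m \<notin> R" "l \<noteq> m" for l m
    using R that leaf_in_verts unfolding resolving_def by blast
  have same_nb: "l = m"
    if "leaf G l" "leaf G m" "l \<notin> R" "m \<notin> R" "nb l = nb m" for l m
    using separate[OF that(1-4)] gdist_leaf(2)[OF that(1) nb[OF that(1)]]
      gdist_leaf(2)[OF that(2) nb[OF that(2)]] that(5) by metis
  have not_nb: "l \<noteq> nb m"
    if lm: "leaf G l" "leaf G m" "l \<notin> R" "m \<notin> R" for l m
  proof
    assume l: "l = nb m"
    have ml: "m \<rightarrow>\<^bsub>G\<^esub> l" and lm_adj: "l \<rightarrow>\<^bsub>G\<^esub> m"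
      using nb[OF lm(2)] l adj_sym by auto
    then obtain v where v: "v \<in> verts G" "v \<noteq> l" "v \<noteq> m"
      using separate[OF lm adj_neq[OF lm_adj]] by blast
    have "gdist G v l = Suc (gdist G v m)" "gdist G v m = Suc (gdist G v l)"
      using gdist_leaf(2)[OF lm(1) lm_adj v(1,2)] gdist_leaf(2)[OF lm(2) ml v(1,3)] .
    then show False by simp
  qed
  have "inj_on f (?L - R)"
  proof (rule inj_onI)
    fix l m assume "l \<in> ?L - R" "m \<in> ?L - R" "f l = f m"
    then show "l = m"
      using same_nb[of l m] not_nb[of l m] not_nb[of m l]
      unfolding f_def by (metis DiffE mem_Collect_eq)
  qed
  then have "card (?L - R) \<le> card S"
    using img fin(2) by (rule card_inj_on_le)
  moreover have "card ?L \<le> card (R \<union> (?L - R))"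
    using fin(1) fin_L by (intro card_mono) auto
  moreover have "\<dots> \<le> card R + card (?L - R)"
    by (rule card_Un_le)
  ultimately show ?thesis by linarith
qed

end


section \<open>Leaves of a tree are doubly resolving\<close>

locale tree_graph = connected_graph +
  assumes acyclic: "cycle p \<Longrightarrow> length p < 3"
begin

text \<open>
  Shortest paths to \<open>y\<close> from two neighbours of \<open>u\<close> that are no farther from \<open>y\<close> than \<open>u\<close>
  cannot pass through \<open>u\<close>, so two such neighbours would be joined by a path that avoids \<open>u\<close>,
  and this path closes to a cycle through \<open>u\<close>.
\<close>

lemma closer_neighbour_unique:
  assumes "y \<in> verts G"
    and "u \<rightarrow>\<^bsub>G\<^esub> a" "gdist G a y \<le> gdist G u y"
    and "u \<rightarrow>\<^bsub>G\<^esub> b" "gdist G b y \<le> gdist G u y"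
  shows "a = b"
proof (rule ccontr)
  assume "a \<noteq> b"
  interpret H: wf_digraph "del_vert u"
    by (rule wf_digraph_del_vert)
  have H_sym: "symmetric (del_vert u)"
    using sym_arcs unfolding symmetric_conv by (auto simp: del_vert_simps)
  have reach: "c \<rightarrow>\<^sup>*\<^bsub>del_vert u\<^esub> y"
    if "c \<in> verts G" "c \<noteq> u" "gdist G c y \<le> gdist G u y" for c
    using that
  proof (induction "gdist G c y" arbitrary: c rule: less_induct)
    case less
    show ?case
    proof (cases "c = y")
      case True
      have "c \<in> verts (del_vert u)"
        using less.prems(1,2) by (simp add: del_vert_simps)
      with True show ?thesis
        by simp
    next
      case False
      then obtain w where w: "c \<rightarrow>\<^bsub>G\<^esub> w" "gdist G c y = Suc (gdist G w y)"
        using gdist_step less.prems(1) assms(1) by metis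
      have "w \<noteq> u" using w(2) less.prems(3) by auto
      then have "c \<rightarrow>\<^bsub>del_vert u\<^esub> w"
        using w(1) less.prems(2) unfolding arcs_ends_conv by (auto simp: del_vert_simps)
      moreover have "w \<rightarrow>\<^sup>*\<^bsub>del_vert u\<^esub> y"
        using less.hyps[of w] w less.prems \<open>w \<noteq> u\<close> adj_in_verts(2) by auto
      ultimately show ?thesis by (rule H.adj_reachable_trans)
    qed
  qed
  have "a \<rightarrow>\<^sup>*\<^bsub>del_vert u\<^esub> y" "b \<rightarrow>\<^sup>*\<^bsub>del_vert u\<^esub> y"
    using reach assms adj_in_verts(2) adj_neq by metis+
  then have "a \<rightarrow>\<^sup>*\<^bsub>del_vert u\<^esub> b"
    using symmetric_reachable[OF H_sym] H.reachable_trans by blast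
  then obtain p where p_H: "H.apath a p b"
    by (auto simp: H.reachable_apath)
  then have "set (H.awalk_verts a p) \<subseteq> verts (del_vert u)"
    by (auto simp: H.apath_def)
  moreover have "H.awalk_verts = awalk_verts"
    by (rule compatible_awalk_verts) (simp add: compatible_def del_vert_simps)
  ultimately have avoid: "u \<notin> set (awalk_verts a p)"
    by (auto simp: del_vert_simps)
  have p: "awalk a p b" "distinct (awalk_verts a p)"
    using subgraph_apath_imp_apath[OF p_H subgraph_del_vert] by (auto simp: apath_def)
  obtain e where e: "e \<in> arcs G" "tail G e = u" "head G e = a"
    using assms(2) by (auto simp: arcs_ends_conv)
  obtain e' where e': "e' \<in> arcs G" "tail G e' = b" "head G e' = u"
    using adj_sym[OF assms(4)] by (auto simp: arcs_ends_conv)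
  have "awalk a (p @ [e']) u"
    using p(1) e' by (intro awalk_appendI[of _ _ b]) (auto dest: arc_implies_awalk)
  moreover then have "awalk_verts a (p @ [e']) = awalk_verts a p @ [u]"
    using p(1) e' by (subst awalk_verts_append) auto
  ultimately have "cycle (e # p @ [e'])"
    unfolding cycle_def using e p(2) avoid
    by (intro exI[of _ u]) (auto simp del: awalk_append_iff simp: awalk_Cons_iff)
  moreover have "p \<noteq> []"
    using p(1) \<open>a \<noteq> b\<close> by (auto simp: awalk_Nil_iff)
  ultimately show False
    using acyclic[of "e # p @ [e']"] by (cases p) auto
qed

text \<open>
  Among the vertices from which a path to \<open>y\<close> leads through \<open>x\<close>, one that is farthest from
  \<open>y\<close> is a leaf: a neighbour farther from \<open>y\<close> would be such a vertex, too, and only one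
  neighbour is not farther.
\<close>

lemma leaf_beyond:
  assumes "x \<in> verts G" "y \<in> verts G" "x \<noteq> y"
  obtains u where "leaf G u" "gdist G u y = gdist G u x + gdist G x y"
proof -
  let ?B = "{u \<in> verts G. gdist G u y = gdist G u x + gdist G x y}"
  have "x \<in> ?B" using assms by (simp add: gdist_self)
  then have "Max ((\<lambda>u. gdist G u y) ` ?B) \<in> (\<lambda>u. gdist G u y) ` ?B"
    by (intro Max_in) auto
  then obtain u where u: "u \<in> ?B" and u_max: "gdist G u y = Max ((\<lambda>u. gdist G u y) ` ?B)"
    by auto
  then have max: "gdist G v y \<le> gdist G u y" if "v \<in> ?B" for v
    unfolding u_max using that by (intro Max_ge) auto
  have not_farther: "gdist G w y \<le> gdist G u y" if uw: "u \<rightarrow>\<^bsub>G\<^esub> w" for w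
  proof (rule ccontr)
    assume far: "\<not> gdist G w y \<le> gdist G u y"
    have w: "w \<in> verts G" using uw by (rule adj_in_verts)
    have "gdist G w x \<le> gdist G w u + gdist G u x"
      using u w assms by (intro gdist_triangle) auto
    moreover have "gdist G w y \<le> gdist G w x + gdist G x y"
      using w assms by (intro gdist_triangle)
    moreover have "gdist G w u \<le> 1"
      using gdist_adj[OF adj_sym[OF uw]] .
    ultimately have "w \<in> ?B"
      using far u w by auto
    with max far show False by blast
  qed
  have "u \<noteq> y"
    using u assms gdist_self gdist_eq_0D by auto
  then obtain w where "u \<rightarrow>\<^bsub>G\<^esub> w"
    using gdist_step[of u y] u assms(2) by auto
  then have "leaf G u"
    unfolding leaf_def using closer_neighbour_unique[OF assms(2)] not_farther by blast
  with u show thesis by (intro that) auto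
qed

lemma leaves_doubly_resolving: "doubly_resolving G {l. leaf G l}"
  unfolding doubly_resolving_def
proof (intro conjI ballI impI)
  show "{l. leaf G l} \<subseteq> verts G"
    by (auto dest: leaf_in_verts)
  fix x y assume xy: "x \<in> verts G" "y \<in> verts G" "x \<noteq> y"
  obtain u where u: "leaf G u" "gdist G u y = gdist G u x + gdist G x y"
    using leaf_beyond[OF xy] .
  obtain v where v: "leaf G v" "gdist G v x = gdist G v y + gdist G y x"
    using leaf_beyond[OF xy(2,1)] xy(3) by blast
  have "gdist G x y > 0" "gdist G y x > 0"
    using xy gdist_eq_0D by (metis gr0I)+
  then have "int (gdist G u x) - int (gdist G u y) \<noteq> int (gdist G v x) - int (gdist G v y)"
    using u(2) v(2) by simp
  then show "\<exists>u \<in> {l. leaf G l}. \<exists>v \<in> {l. leaf G l}.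
      int (gdist G u x) - int (gdist G u y) \<noteq> int (gdist G v x) - int (gdist G v y)"
    using u(1) v(1) by blast
qed

end

lemma finite_tree_tree_graph: "finite_tree T \<Longrightarrow> tree_graph T"
  unfolding finite_tree_def tree_graph_def connected_graph_def
    tree_graph_axioms_def connected_graph_axioms_def
  by (metis not_le)

theorem theorem19:
  fixes T :: "('a, 'b) pre_digraph"
  assumes "finite_tree T"
  shows "psi T \<le> metric_dim T + eqdim T"
proof -
  interpret tree_graph T
    by (rule finite_tree_tree_graph[OF assms])
  have "\<exists>n R. resolving T R \<and> card R = n"
    using resolving_verts by blast
  from LeastI_ex[OF this] obtain R where R: "resolving T R" "card R = metric_dim T"
    unfolding metric_dim_def by blast
  have "distance_equalizer T (verts T)"
    by (simp add: distance_equalizer_def)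
  then have "\<exists>n S. distance_equalizer T S \<and> card S = n"
    by blast
  from LeastI_ex[OF this] obtain S where S: "distance_equalizer T S" "card S = eqdim T"
    unfolding eqdim_def by blast
  have "psi T \<le> card {l. leaf T l}"
    unfolding psi_def using leaves_doubly_resolving by (intro Least_le) blast
  also have "\<dots> \<le> card R + card S"
    by (rule card_leaves_le[OF R(1) S(1)])
  finally show ?thesis
    using R(2) S(2) by simp
qed

end
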